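(* Let $k \geq 2$ be an integer. If either Max moves first and $k$ is even, or Mini moves first and $k$ is odd, then $s(n, \mathcal{M}_k) \geq n-1$. In all other cases (Max moves first and $k$ is odd, or Mini moves first and $k$ is even), $s(n, \mathcal{M}_k) \leq \binom{2k-1}{2}$.
   Context: Let $\mathcal{P}$ be a monotone increasing property of graphs on vertex set $[n]$. An edge $e \in \binom{[n]}{2}\setminus E(G)$ is legal with respect to a graph $G \notin \mathcal{P}$ if $G \cup \{e\} \notin \mathcal{P}$. The saturation game $(n,\mathcal{P})$: starting from the empty graph on $[n]$, two players, Mini and Max, alternately add a legal edge to the current graph $G$. The game ends when no legal edge exists. Max wants to maximize the number of edges of the final graph and Mini wants to minimize it. The score $s(n,\mathcal{P})$ is the number of edges of the final graph under optimal play by both players; it may depend on which player moves first. $\mathcal{M}_k$ denotes the property of admitting a matching of size $k$. *)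

theory Defs
  imports Main "HOL-Library.Disjoint_Sets"
begin

text \<open>
  A graph on the vertex set \<open>[n] = {1..n}\<close> is identified with its edge set, a subset of
  \<open>pairs n\<close>; a graph property is a set of such edge sets.
\<close>

type_synonym graph = "nat set set"

definition pairs :: "nat \<Rightarrow> graph" where
  "pairs n = {e. e \<subseteq> {1..n} \<and> card e = 2}"

definition monotone_increasing :: "nat \<Rightarrow> graph set \<Rightarrow> bool" where
  "monotone_increasing n P \<longleftrightarrow>
     P \<subseteq> Pow (pairs n) \<and> (\<forall>G H. G \<in> P \<and> G \<subseteq> H \<and> H \<subseteq> pairs n \<longrightarrow> H \<in> P)"

definition legal_edges :: "nat \<Rightarrow> graph set \<Rightarrow> graph \<Rightarrow> graph" where
  "legal_edges n P G = {e \<in> pairs n - G. insert e G \<notin> P}"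

datatype player = Mini | Max

hide_const (open) Mini Max

fun opponent :: "player \<Rightarrow> player" where
  "opponent player.Mini = player.Max"
| "opponent player.Max = player.Mini"

lemma finite_pairs: "finite (pairs n)"
  unfolding pairs_def by (rule finite_subset[of _ "Pow {1..n}"]) auto

lemma card_pairs_diff_less:
  assumes "e \<in> legal_edges n P G"
  shows "card (pairs n - insert e G) < card (pairs n - G)"
  using assms finite_pairs[of n]
  by (intro psubset_card_mono) (auto simp: legal_edges_def)

text \<open>
  \<open>game_value n P p G\<close> is the number of edges of the final graph when both players play
  optimally from the position \<open>G\<close> with \<open>p\<close> to move (backward induction on the finite game tree).
\<close>

function game_value :: "nat \<Rightarrow> graph set \<Rightarrow> player \<Rightarrow> graph \<Rightarrow> nat" where
  "game_value n P p G =
     (if legal_edges n P G = {} then card G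
      else case p of
        player.Max \<Rightarrow>
          Lattices_Big.Max ((\<lambda>e. game_value n P (opponent p) (insert e G)) ` legal_edges n P G)
      | player.Mini \<Rightarrow>
          Min ((\<lambda>e. game_value n P (opponent p) (insert e G)) ` legal_edges n P G))"
  by pat_completeness auto
termination
  by (relation "measure (\<lambda>(n, P, p, G). card (pairs n - G))") (auto intro: card_pairs_diff_less)

declare game_value.simps [simp del]

text \<open>The second argument of \<open>score\<close> is the player who moves first.\<close>

definition score :: "nat \<Rightarrow> player \<Rightarrow> graph set \<Rightarrow> nat" where
  "score n p P = game_value n P p {}"

definition matching :: "graph \<Rightarrow> graph \<Rightarrow> bool" where
  "matching G M \<longleftrightarrow> M \<subseteq> G \<and> disjoint M"

definition matching_property :: "nat \<Rightarrow> nat \<Rightarrow> graph set" where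
  "matching_property n k = {G. G \<subseteq> pairs n \<and> (\<exists>M. matching G M \<and> card M = k)}"

lemma monotone_increasing_matching_property:
  "monotone_increasing n (matching_property n k)"
  unfolding monotone_increasing_def matching_property_def matching_def by blast

end

theory Submission
  imports Defs "HOL-Library.Ramsey"
begin

text \<open>
  For \<open>n < 2k\<close> the game ends with the complete graph. Otherwise the favoured player keeps a partition of
  the vertices into blocks that contain all edges, odd blocks being factor-critical and even blocks having
  a perfect matching and being robust against the attachment of an odd block. The matching number is
  then the sum of \<open>\<lfloor>|B|/2\<rfloor>\<close> over the blocks. When the opponent joins an even block to another block, one
  further edge between the two repairs the structure; joining two odd blocks needs no repair.

  The favoured player leaves \<open>k - 1\<close> edges modulo 2 after each of her moves. If all blocks are complete,
  then the number of edges is congruent to the matching number, so when she is to move either a block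
  is incomplete or the matching number is below \<open>k - 1\<close>, and she has a move that keeps the structure.

  If Mini is favoured, the structure alone bounds the number of edges. If Max is favoured, he also has
  an even block whenever the matching number is \<open>k - 1\<close>. Mini eventually has to join some \<open>a\<close> in an even
  block to an odd block; Max then joins \<open>a\<close> to a second odd block, after which \<open>a\<close> lies in every maximum
  matching for good, so that in the end \<open>a\<close> is adjacent to all other vertices.
\<close>

section \<open>Strategies in saturation games\<close>

fun prefers :: "player \<Rightarrow> nat \<Rightarrow> nat \<Rightarrow> bool" where
  "prefers player.Mini v w \<longleftrightarrow> v \<le> w"
| "prefers player.Max v w \<longleftrightarrow> w \<le> v"

lemma prefers_trans: "prefers p u v \<Longrightarrow> prefers p v w \<Longrightarrow> prefers p u w"
  by (cases p) auto

lemma opponent_opponent [simp]: "opponent (opponent p) = p"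
  by (cases p) auto

lemma finite_legal_edges: "finite (legal_edges n P G)"
  using finite_pairs[of n] by (simp add: legal_edges_def)

lemma game_value_terminal: "legal_edges n P G = {} \<Longrightarrow> game_value n P p G = card G"
  by (subst game_value.simps) simp

lemma game_value_attained:
  assumes "legal_edges n P G \<noteq> {}"
  shows "\<exists>e\<in>legal_edges n P G. game_value n P p G = game_value n P (opponent p) (insert e G)"
proof -
  define child_values where
    "child_values = (\<lambda>e. game_value n P (opponent p) (insert e G)) ` legal_edges n P G"
  have "game_value n P p G =
      (case p of player.Max \<Rightarrow> Max child_values | player.Mini \<Rightarrow> Min child_values)"
    using assms unfolding child_values_def by (subst game_value.simps) simp
  moreover have "finite child_values" "child_values \<noteq> {}"
    using assms finite_legal_edges by (auto simp: child_values_def)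
  ultimately have "game_value n P p G \<in> child_values"
    using Min_in Max_in by (cases p) auto
  then show ?thesis
    by (auto simp: child_values_def)
qed

lemma prefers_game_value:
  assumes "e \<in> legal_edges n P G"
  shows "prefers p (game_value n P p G) (game_value n P (opponent p) (insert e G))"
proof -
  have "legal_edges n P G \<noteq> {}"
    using assms by blast
  then show ?thesis
    using assms finite_legal_edges[of n P G]
    by (subst game_value.simps) (cases p; simp)
qed

lemma game_value_invariant:
  assumes "Q G"
    and move: "\<And>G e. Q G \<Longrightarrow> e \<in> legal_edges n P G \<Longrightarrow> Q (insert e G)"
    and final: "\<And>G. Q G \<Longrightarrow> legal_edges n P G = {} \<Longrightarrow> R (card G)"
  shows "R (game_value n P p G)"
  using \<open>Q G\<close>
proof (induction "card (pairs n - G)" arbitrary: G p rule: less_induct)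
  case less
  show ?case
  proof (cases "legal_edges n P G = {}")
    case True
    then show ?thesis
      using final less.prems by (simp add: game_value_terminal)
  next
    case False
    then obtain e where "e \<in> legal_edges n P G"
        and "game_value n P p G = game_value n P (opponent p) (insert e G)"
      using game_value_attained by blast
    then show ?thesis
      using less.hyps[OF card_pairs_diff_less[of e n P G]] move less.prems by metis
  qed
qed

lemma strategy_value:
  assumes "Q G"
    and reply: "\<And>G e. Q G \<Longrightarrow> e \<in> legal_edges n P G \<Longrightarrow>
      \<exists>f\<in>legal_edges n P (insert e G). Q (insert f (insert e G)) \<or>
        prefers p (game_value n P (opponent p) (insert f (insert e G))) m"
    and final: "\<And>G. Q G \<Longrightarrow> legal_edges n P G = {} \<Longrightarrow> prefers p (card G) m"
  shows "prefers p (game_value n P (opponent p) G) m"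
  using \<open>Q G\<close>
proof (induction "card (pairs n - G)" arbitrary: G rule: less_induct)
  case less
  show ?case
  proof (cases "legal_edges n P G = {}")
    case True
    then show ?thesis
      using final less.prems by (simp add: game_value_terminal)
  next
    case False
    then obtain e where e: "e \<in> legal_edges n P G"
        and value_e: "game_value n P (opponent p) G = game_value n P p (insert e G)"
      using game_value_attained[of n P G "opponent p"] by auto
    obtain f where f: "f \<in> legal_edges n P (insert e G)"
        and "Q (insert f (insert e G)) \<or>
          prefers p (game_value n P (opponent p) (insert f (insert e G))) m"
      using reply less.prems e by blast
    moreover have "card (pairs n - insert f (insert e G)) < card (pairs n - G)"
      using card_pairs_diff_less[OF e] card_pairs_diff_less[OF f] by linarith
    ultimately have "prefers p (game_value n P (opponent p) (insert f (insert e G))) m"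
      using less.hyps by blast
    then show ?thesis
      using prefers_trans[OF prefers_game_value[OF f]] value_e by simp
  qed
qed

section \<open>Matchings\<close>

definition matchings :: "'a set set \<Rightarrow> 'a set set set" where
  "matchings G = {M. M \<subseteq> G \<and> disjoint M}"

definition matching_number :: "'a set set \<Rightarrow> nat" where
  "matching_number G = Max (card ` matchings G)"

lemma matchings_mono: "G \<subseteq> H \<Longrightarrow> matchings G \<subseteq> matchings H"
  by (auto simp: matchings_def)

lemma matchings_subset: "M \<in> matchings G \<Longrightarrow> N \<subseteq> M \<Longrightarrow> N \<in> matchings G"
  by (auto simp: matchings_def intro: pairwise_subset)

lemma empty_in_matchings [simp]: "{} \<in> matchings G"
  by (simp add: matchings_def)

lemma finite_matching: "finite G \<Longrightarrow> M \<in> matchings G \<Longrightarrow> finite M"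
  by (auto simp: matchings_def intro: finite_subset)

lemma finite_matchings: "finite G \<Longrightarrow> finite (matchings G)"
  by (simp add: matchings_def)

lemma insert_in_matchings:
  assumes "M \<in> matchings G" "e \<in> G" "e \<inter> \<Union>M = {}"
  shows "insert e M \<in> matchings G"
  using assms by (auto simp: matchings_def pairwise_insert disjnt_def)

lemma card_insert_matching:
  assumes "finite M" "e \<noteq> {}" "e \<inter> \<Union>M = {}"
  shows "card (insert e M) = Suc (card M)"
  using assms by (intro card_insert_disjoint) auto

lemma Un_in_matchings:
  assumes "M \<in> matchings G" "N \<in> matchings G" "\<Union>M \<inter> \<Union>N = {}"
  shows "M \<union> N \<in> matchings G"
  using assms disjoint_union[of M N] by (simp add: matchings_def)

lemma Union_Diff_matching_edge:
  assumes "M \<in> matchings G" "e \<in> M"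
  shows "\<Union>(M - {e}) = \<Union>M - e"
  using assms disjointD[of M] by (fastforce simp: matchings_def)

lemma card_Union_matching:
  assumes "M \<in> matchings G" "G \<subseteq> [V]\<^bsup>2\<^esup>"
  shows "card (\<Union>M) = 2 * card M"
proof -
  have edge: "finite e" "card e = 2" if "e \<in> M" for e
    using assms that by (auto simp: matchings_def nsets_def)
  have "card (\<Union>M) = sum card M"
    using assms(1) edge(1) by (intro card_Union_disjoint) (auto simp: matchings_def)
  then show ?thesis
    using edge(2) by simp
qed

lemma card_le_matching_number:
  "finite G \<Longrightarrow> M \<in> matchings G \<Longrightarrow> card M \<le> matching_number G"
  by (simp add: matching_number_def finite_matchings)

lemma obtain_maximum_matching:
  assumes "finite G"
  obtains M where "M \<in> matchings G" "card M = matching_number G"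
proof -
  have "matching_number G \<in> card ` matchings G"
    unfolding matching_number_def
    by (rule Max_in) (use assms finite_matchings empty_in_matchings in blast)+
  then show thesis
    using that by auto
qed

lemma matching_number_mono:
  assumes "finite H" "G \<subseteq> H"
  shows "matching_number G \<le> matching_number H"
proof -
  obtain M where "M \<in> matchings G" "card M = matching_number G"
    using assms finite_subset obtain_maximum_matching by metis
  then show ?thesis
    using assms card_le_matching_number matchings_mono by (metis subsetD)
qed

lemma twice_matching_number_le:
  assumes "finite V" "G \<subseteq> [V]\<^bsup>2\<^esup>"
  shows "2 * matching_number G \<le> card V"
proof -
  have "finite G"
    using assms finite_imp_finite_nsets finite_subset by blast
  then obtain M where M: "M \<in> matchings G" "card M = matching_number G"
    using obtain_maximum_matching by blast
  then have "\<Union>M \<subseteq> V"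
    using assms(2) by (auto simp: matchings_def nsets_def)
  then show ?thesis
    using card_Union_matching[OF M(1) assms(2)] M(2) card_mono[OF assms(1)] by metis
qed

lemma card_ge_universal_vertex:
  assumes "finite G" "\<And>w. w \<in> V - {a} \<Longrightarrow> {a, w} \<in> G"
  shows "card (V - {a}) \<le> card G"
proof (rule card_inj_on_le)
  show "inj_on (\<lambda>w. {a, w}) (V - {a})"
    by (auto simp: inj_on_def doubleton_eq_iff)
qed (use assms in auto)

lemma matching_number_insert_intersecting:
  assumes "finite G" "e \<inter> f \<noteq> {}"
  shows "matching_number (insert e (insert f G)) =
    max (matching_number (insert e G)) (matching_number (insert f G))"
proof (rule antisym)
  obtain M where M: "M \<in> matchings (insert e (insert f G))"
      "card M = matching_number (insert e (insert f G))"
    using assms(1) obtain_maximum_matching by (metis finite_insert)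
  have "e = f \<or> e \<notin> M \<or> f \<notin> M"
    using M(1) assms(2) disjointD[of M e f] by (auto simp: matchings_def)
  then have "M \<in> matchings (insert e G) \<or> M \<in> matchings (insert f G)"
    using M(1) unfolding matchings_def by blast
  then show "matching_number (insert e (insert f G)) \<le>
      max (matching_number (insert e G)) (matching_number (insert f G))"
    using M(2) assms(1) card_le_matching_number by (metis finite_insert max.coboundedI1 max.coboundedI2)
  show "max (matching_number (insert e G)) (matching_number (insert f G)) \<le>
      matching_number (insert e (insert f G))"
    using assms(1) by (intro max.boundedI matching_number_mono) auto
qed

lemma obtain_matching_edge:
  assumes "M \<in> matchings G" "G \<subseteq> [V]\<^bsup>2\<^esup>" "u \<in> \<Union>M"
  obtains v where "v \<noteq> u" "{u, v} \<in> M"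
proof -
  obtain e where e: "e \<in> M" "u \<in> e"
    using assms(3) by blast
  then have "e \<in> [V]\<^bsup>2\<^esup>"
    using assms(1,2) by (auto simp: matchings_def)
  then obtain x y where "e = {x, y}" "x \<noteq> y"
    by (rule nsets2_E)
  then show thesis
    using e that[of x] that[of y] by (auto simp: insert_commute)
qed

text \<open>
  The two outcomes of following the path of alternating \<open>M\<close>- and \<open>N\<close>-edges that starts in \<open>a\<close>: if
  its last edge lies in \<open>M\<close>, exchanging along it enlarges \<open>N\<close>, otherwise it turns \<open>M\<close> into \<open>M'\<close>.
\<close>

definition path_exchange :: "'a set set \<Rightarrow> 'a set set \<Rightarrow> 'a \<Rightarrow> bool" where
  "path_exchange M N a \<longleftrightarrow>
    (\<exists>K\<in>matchings (M \<union> N). card K = Suc (card N)) \<or>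
    (\<exists>M'\<in>matchings (M \<union> N). card M' = card M \<and> a \<notin> \<Union>M' \<and> \<Union>M - {a} \<subseteq> \<Union>M')"

lemma path_exchange_step:
  assumes fin: "finite M" "finite N" and M: "M \<in> matchings G" and N: "N \<in> matchings G"
    and ab: "b \<noteq> a" "{a, b} \<in> M" and bc: "{b, c} \<in> N" and "a \<notin> \<Union>N"
    and rest: "path_exchange (M - {{a, b}}) (N - {{b, c}}) c"
  shows "path_exchange M N a"
proof -
  define M0 N0 where "M0 = M - {{a, b}}" and "N0 = N - {{b, c}}"
  have "c \<noteq> a"
    using bc \<open>a \<notin> \<Union>N\<close> by blast
  have avoid: "a \<notin> \<Union>(M0 \<union> N0)" "b \<notin> \<Union>(M0 \<union> N0)"
    using \<open>a \<notin> \<Union>N\<close> Union_Diff_matching_edge[OF M ab(2)] Union_Diff_matching_edge[OF N bc]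
    by (auto simp: M0_def N0_def)
  have card_M: "card M = Suc (card M0)" and card_N: "card N = Suc (card N0)"
    using card_Suc_Diff1[OF fin(1) ab(2)] card_Suc_Diff1[OF fin(2) bc] by (simp_all add: M0_def N0_def)
  have rest_matching: "finite L" "\<Union>L \<subseteq> \<Union>(M0 \<union> N0)" "L \<in> matchings (M \<union> N)"
    if "L \<in> matchings (M0 \<union> N0)" for L
    using that fin by (auto simp: matchings_def M0_def N0_def intro: finite_subset)
  consider (augmented) K where "K \<in> matchings (M0 \<union> N0)" "card K = Suc (card N0)"
    | (freed) M' where "M' \<in> matchings (M0 \<union> N0)" "card M' = card M0" "c \<notin> \<Union>M'" "\<Union>M0 - {c} \<subseteq> \<Union>M'"
    using rest unfolding path_exchange_def M0_def[symmetric] N0_def[symmetric] by blast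
  then show ?thesis
  proof cases
    case (augmented K)
    then have "{a, b} \<inter> \<Union>K = {}"
      using avoid rest_matching(2)[OF augmented(1)] by blast
    then have "insert {a, b} K \<in> matchings (M \<union> N)" "card (insert {a, b} K) = Suc (card N)"
      using rest_matching[OF augmented(1)] augmented(2) ab card_N
      by (simp_all add: insert_in_matchings card_insert_matching)
    then show ?thesis
      unfolding path_exchange_def by blast
  next
    case (freed M')
    have "{b, c} \<inter> \<Union>M' = {}"
      using avoid(2) freed(3) rest_matching(2)[OF freed(1)] by blast
    then have "insert {b, c} M' \<in> matchings (M \<union> N)" "card (insert {b, c} M') = card M"
      using rest_matching[OF freed(1)] freed(2) bc card_M
      by (simp_all add: insert_in_matchings card_insert_matching)
    moreover have "a \<notin> \<Union>(insert {b, c} M')"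
      using avoid(1) rest_matching(2)[OF freed(1)] \<open>c \<noteq> a\<close> ab(1) by auto
    moreover have "\<Union>M - {a} \<subseteq> \<Union>(insert {b, c} M')"
      using freed(4) by (auto simp: M0_def)
    ultimately show ?thesis
      unfolding path_exchange_def by blast
  qed
qed

lemma path_exchangeI:
  assumes "finite M" "finite N" "M \<in> matchings G" "N \<in> matchings G" "G \<subseteq> [V]\<^bsup>2\<^esup>" "a \<notin> \<Union>N"
  shows "path_exchange M N a"
  using assms
proof (induction "card M" arbitrary: M N a rule: less_induct)
  case less
  note fin = less.prems(1,2) and M = less.prems(3) and N = less.prems(4)
  have in_Un: "M \<in> matchings (M \<union> N)" "N \<in> matchings (M \<union> N)"
    using M N by (auto simp: matchings_def)
  consider (uncovered) "a \<notin> \<Union>M" | (last) b where "{a, b} \<in> M" "b \<notin> \<Union>N"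
    | (step) b c where "b \<noteq> a" "{a, b} \<in> M" "{b, c} \<in> N"
    using obtain_matching_edge[OF M less.prems(5)] obtain_matching_edge[OF N less.prems(5)] by metis
  then show ?case
  proof cases
    case uncovered
    then show ?thesis
      unfolding path_exchange_def using in_Un(1) by blast
  next
    case (last b)
    then have "insert {a, b} N \<in> matchings (M \<union> N)" "card (insert {a, b} N) = Suc (card N)"
      using in_Un(2) fin(2) less.prems(6) by (auto intro!: insert_in_matchings card_insert_matching)
    then show ?thesis
      unfolding path_exchange_def by blast
  next
    case (step b c)
    have "card (M - {{a, b}}) < card M"
      using fin(1) step(2) by (rule card_Diff1_less)
    moreover have "c \<notin> \<Union>(N - {{b, c}})"
      using Union_Diff_matching_edge[OF N step(3)] by simp
    ultimately have "path_exchange (M - {{a, b}}) (N - {{b, c}}) c"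
      using less.hyps fin matchings_subset[OF M] matchings_subset[OF N] less.prems(5) by simp
    then show ?thesis
      using path_exchange_step[OF fin M N step less.prems(6)] by blast
  qed
qed

lemma exchanged_matching_misses:
  assumes G: "finite G" "G \<subseteq> [V]\<^bsup>2\<^esup>" and M: "M \<in> matchings G" "M' \<in> matchings G"
    and "card M' = card M" "\<Union>M - {a} \<subseteq> \<Union>M'" and xy: "x \<noteq> y" "x \<notin> \<Union>M" "y \<notin> \<Union>M"
  shows "x \<notin> \<Union>M' \<or> y \<notin> \<Union>M'"
proof (rule ccontr)
  have fin: "finite (\<Union>L)" if "L \<in> matchings G" for L
    using that G(2) finite_matching[OF G(1) that] by (auto simp: matchings_def nsets_def)
  assume "\<not> (x \<notin> \<Union>M' \<or> y \<notin> \<Union>M')"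
  then have "card (insert x (insert y (\<Union>M - {a}))) \<le> card (\<Union>M')"
    using assms(6) fin[OF M(2)] by (intro card_mono) auto
  moreover have "card (\<Union>M') = card (\<Union>M)"
    using card_Union_matching G(2) M assms(5) by metis
  moreover have "card (insert x (insert y (\<Union>M - {a}))) = 2 + card (\<Union>M - {a})"
    using xy fin[OF M(1)] by simp
  ultimately show False
    using diff_card_le_card_Diff[of "{a}" "\<Union>M"] by simp
qed

definition pinned :: "'a set set \<Rightarrow> 'a \<Rightarrow> bool" where
  "pinned G a \<longleftrightarrow> (\<exists>M\<in>matchings G. card M = matching_number G \<and>
    (\<exists>x y. x \<noteq> y \<and> x \<notin> \<Union>M \<and> y \<notin> \<Union>M \<and> {a, x} \<in> G \<and> {a, y} \<in> G))"

lemma pinned_mono: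
  assumes "pinned G a" "G \<subseteq> H" "matching_number H = matching_number G"
  shows "pinned H a"
  using assms matchings_mono[OF assms(2)] unfolding pinned_def by (metis subsetD)

text \<open>
  Freeing \<open>a\<close> along an alternating path covers at most one of \<open>x\<close> and \<open>y\<close>, so \<open>a\<close> could then be matched
  to the other one.
\<close>

lemma pinned_in_maximum_matching:
  assumes G: "finite G" "G \<subseteq> [V]\<^bsup>2\<^esup>" "pinned G a"
    and N: "N \<in> matchings G" "card N = matching_number G"
  shows "a \<in> \<Union>N"
proof (rule ccontr)
  assume "a \<notin> \<Union>N"
  obtain M x y where M: "M \<in> matchings G" "card M = matching_number G"
    and xy: "x \<noteq> y" "x \<notin> \<Union>M" "y \<notin> \<Union>M" "{a, x} \<in> G" "{a, y} \<in> G"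
    using G(3) unfolding pinned_def by blast
  have sub: "matchings (M \<union> N) \<subseteq> matchings G"
    using M(1) N(1) by (intro matchings_mono) (auto simp: matchings_def)
  have "card K \<noteq> Suc (card N)" if "K \<in> matchings (M \<union> N)" for K
    using card_le_matching_number[OF G(1), of K] that sub N(2) by auto
  moreover have "path_exchange M N a"
    using finite_matching[OF G(1) M(1)] finite_matching[OF G(1) N(1)] M(1) N(1) G(2) \<open>a \<notin> \<Union>N\<close>
    by (rule path_exchangeI)
  ultimately obtain M' where M': "M' \<in> matchings G" "card M' = card M" "a \<notin> \<Union>M'" "\<Union>M - {a} \<subseteq> \<Union>M'"
    unfolding path_exchange_def using sub by blast
  then obtain z where z: "{a, z} \<in> G" "z \<notin> \<Union>M'"
    using exchanged_matching_misses[OF G(1,2) M(1)] xy by metis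
  then have "{a, z} \<inter> \<Union>M' = {}"
    using M'(3) by blast
  then have "insert {a, z} M' \<in> matchings G" "card (insert {a, z} M') = Suc (matching_number G)"
    using z(1) M'(1,2) M(2) finite_matching[OF G(1)] by (simp_all add: insert_in_matchings card_insert_matching)
  then show False
    using card_le_matching_number[OF G(1)] by fastforce
qed

lemma matching_number_insert_at_pinned:
  assumes "finite G" "G \<subseteq> [V]\<^bsup>2\<^esup>" "pinned G a" "a \<in> e"
  shows "matching_number (insert e G) = matching_number G"
proof (rule antisym)
  obtain K where K: "K \<in> matchings (insert e G)" "card K = matching_number (insert e G)"
    using assms(1) obtain_maximum_matching by (metis finite_insert)
  show "matching_number (insert e G) \<le> matching_number G"
  proof (cases "e \<in> K")
    case True
    have "K - {e} \<in> matchings G" "a \<notin> \<Union>(K - {e})"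
      using K(1) assms(4) Union_Diff_matching_edge[OF K(1) True]
      by (auto simp: matchings_def intro: pairwise_subset)
    then have "card (K - {e}) < matching_number G"
      using pinned_in_maximum_matching[OF assms(1-3)] card_le_matching_number[OF assms(1)]
      by (metis le_neq_implies_less)
    then show ?thesis
      using K(2) card_Diff_singleton[OF True] by simp
  next
    case False
    then have "K \<in> matchings G"
      using K(1) by (auto simp: matchings_def)
    then show ?thesis
      using card_le_matching_number[OF assms(1)] K(2) by metis
  qed
  show "matching_number G \<le> matching_number (insert e G)"
    using assms(1) by (intro matching_number_mono) auto
qed

section \<open>Factor-critical and extendable blocks\<close>

definition perfectly_matched :: "'a set set \<Rightarrow> 'a set \<Rightarrow> bool" where
  "perfectly_matched G S \<longleftrightarrow> (\<exists>M\<in>matchings G. \<Union>M = S)"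

definition factor_critical :: "'a set set \<Rightarrow> 'a set \<Rightarrow> bool" where
  "factor_critical G B \<longleftrightarrow> (\<forall>y\<in>B. perfectly_matched G (B - {y}))"

text \<open>
  Joining a new vertex \<open>x\<close> to \<open>a\<close> and \<open>b\<close> makes \<open>B \<union> {x}\<close> factor-critical, provided that \<open>B\<close> has a perfect
  matching; \<open>x\<close> itself is eliminated, as after deleting \<open>y\<close> it has to be matched to \<open>a\<close> or to \<open>b\<close>.
\<close>

definition attachment_pair :: "'a set set \<Rightarrow> 'a set \<Rightarrow> 'a \<Rightarrow> 'a \<Rightarrow> bool" where
  "attachment_pair G B a b \<longleftrightarrow> a \<in> B \<and> b \<in> B \<and>
     (\<forall>y\<in>B. \<exists>c\<in>{a, b}. c \<noteq> y \<and> perfectly_matched G (B - {y} - {c}))"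

definition extendable :: "'a set set \<Rightarrow> 'a set \<Rightarrow> bool" where
  "extendable G B \<longleftrightarrow> perfectly_matched G B \<and> (\<forall>a\<in>B. \<exists>b. attachment_pair G B a b)"

lemma perfectly_matched_mono: "perfectly_matched G S \<Longrightarrow> G \<subseteq> H \<Longrightarrow> perfectly_matched H S"
  unfolding perfectly_matched_def using matchings_mono by blast

lemma perfectly_matched_empty [simp]: "perfectly_matched G {}"
  unfolding perfectly_matched_def by (intro bexI[of _ "{}"]) auto

lemma perfectly_matched_edge: "e \<in> G \<Longrightarrow> perfectly_matched G e"
  unfolding perfectly_matched_def by (intro bexI[of _ "{e}"]) (auto simp: matchings_def)

lemma perfectly_matched_Un:
  assumes "perfectly_matched G S" "perfectly_matched G T" "S \<inter> T = {}"
  shows "perfectly_matched G (S \<union> T)"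
  using assms Un_in_matchings unfolding perfectly_matched_def by (metis Union_Un_distrib)

lemma perfectly_matched_UN:
  assumes "finite I" "\<And>i. i \<in> I \<Longrightarrow> perfectly_matched G (S i)" "disjoint_family_on S I"
  shows "perfectly_matched G (\<Union>i\<in>I. S i)"
  using assms
proof (induction I)
  case (insert i I)
  then show ?case
    using perfectly_matched_Un[of G "S i" "\<Union>j\<in>I. S j"] by (auto simp: disjoint_family_on_insert)
qed simp

lemma perfectly_matched_bridge:
  assumes "perfectly_matched G (A - {p})" "perfectly_matched G (B - {q})"
    and "A \<inter> B = {}" "p \<in> A" "q \<in> B" "{p, q} \<in> G"
  shows "perfectly_matched G (A \<union> B)"
proof -
  have "perfectly_matched G ((A - {p}) \<union> (B - {q}) \<union> {p, q})"
    using assms by (intro perfectly_matched_Un) (auto simp: perfectly_matched_edge)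
  moreover have "(A - {p}) \<union> (B - {q}) \<union> {p, q} = A \<union> B"
    using assms(4,5) by auto
  ultimately show ?thesis
    by simp
qed

lemma factor_critical_mono: "factor_critical G B \<Longrightarrow> G \<subseteq> H \<Longrightarrow> factor_critical H B"
  unfolding factor_critical_def using perfectly_matched_mono by blast

lemma attachment_pair_mono: "attachment_pair G B a b \<Longrightarrow> G \<subseteq> H \<Longrightarrow> attachment_pair H B a b"
  unfolding attachment_pair_def using perfectly_matched_mono by metis

lemma extendable_mono: "extendable G B \<Longrightarrow> G \<subseteq> H \<Longrightarrow> extendable H B"
  unfolding extendable_def using perfectly_matched_mono attachment_pair_mono by metis

lemma attachment_pair_commute: "attachment_pair G B a b \<longleftrightarrow> attachment_pair G B b a"
  by (auto simp: attachment_pair_def)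

lemma attachment_pair_neq: "attachment_pair G B a b \<Longrightarrow> a \<noteq> b"
  by (auto simp: attachment_pair_def)

lemma factor_critical_singleton: "factor_critical G {v}"
  by (simp add: factor_critical_def)

lemma attachment_pair_join_factor_critical:
  assumes A: "factor_critical G A" and B: "factor_critical G B"
    and "A \<inter> B = {}" "a \<in> A" "b \<in> B"
  shows "attachment_pair G (A \<union> B) a b"
  unfolding attachment_pair_def
proof (intro conjI ballI)
  fix y assume "y \<in> A \<union> B"
  then consider (in_A) "y \<in> A" | (in_B) "y \<in> B"
    by blast
  then show "\<exists>c\<in>{a, b}. c \<noteq> y \<and> perfectly_matched G (A \<union> B - {y} - {c})"
  proof cases
    case in_A
    then have "perfectly_matched G ((A - {y}) \<union> (B - {b}))"
      using assms by (intro perfectly_matched_Un) (auto simp: factor_critical_def)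
    moreover have "A \<union> B - {y} - {b} = (A - {y}) \<union> (B - {b})" "b \<noteq> y"
      using in_A assms(3-5) by auto
    ultimately show ?thesis
      by (intro bexI[of _ b]) auto
  next
    case in_B
    then have "perfectly_matched G ((A - {a}) \<union> (B - {y}))"
      using assms by (intro perfectly_matched_Un) (auto simp: factor_critical_def)
    moreover have "A \<union> B - {y} - {a} = (A - {a}) \<union> (B - {y})" "a \<noteq> y"
      using in_B assms(3-5) by auto
    ultimately show ?thesis
      by (intro bexI[of _ a]) auto
  qed
qed (use assms in auto)

lemma extendable_join_factor_critical:
  assumes A: "factor_critical G A" and B: "factor_critical G B"
    and disj: "A \<inter> B = {}" and uv: "u \<in> A" "v \<in> B" "{u, v} \<in> G"
  shows "extendable G (A \<union> B)"
  unfolding extendable_def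
proof
  show "perfectly_matched G (A \<union> B)"
    using A B disj uv by (intro perfectly_matched_bridge) (auto simp: factor_critical_def)
  show "\<forall>a\<in>A \<union> B. \<exists>b. attachment_pair G (A \<union> B) a b"
    using attachment_pair_join_factor_critical[OF A B disj] attachment_pair_commute uv by (metis UnE)
qed

lemma attachment_pair_join_extendable:
  assumes A: "attachment_pair G A a b" "attachment_pair G A u u'"
    and B: "perfectly_matched G B" "attachment_pair G B v v'"
    and disj: "A \<inter> B = {}" and edges: "{u, v} \<in> G" "{u', v'} \<in> G"
  shows "attachment_pair G (A \<union> B) a b"
  unfolding attachment_pair_def
proof (intro conjI ballI)
  show "a \<in> A \<union> B" "b \<in> A \<union> B"
    using A(1) by (simp_all add: attachment_pair_def)
  have mem_A: "c \<in> A" if "c \<in> {a, b}" for c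
    using that A(1) by (auto simp: attachment_pair_def)
  fix y assume "y \<in> A \<union> B"
  then consider (in_A) "y \<in> A" | (in_B) "y \<in> B"
    by blast
  then show "\<exists>c\<in>{a, b}. c \<noteq> y \<and> perfectly_matched G (A \<union> B - {y} - {c})"
  proof cases
    case in_A
    then obtain c where c: "c \<in> {a, b}" "c \<noteq> y" "perfectly_matched G (A - {y} - {c})"
      using A(1) unfolding attachment_pair_def by blast
    have "perfectly_matched G (A - {y} - {c} \<union> B)"
      using c(3) B(1) by (rule perfectly_matched_Un) (use disj in blast)
    moreover have "A \<union> B - {y} - {c} = A - {y} - {c} \<union> B"
      using in_A mem_A[OF c(1)] disj by blast
    ultimately show ?thesis
      using c(1,2) by metis
  next
    case in_B
    obtain p q where pq: "p \<in> A" "q \<in> B" "{p, q} \<in> G" "q \<noteq> y" "perfectly_matched G (B - {y} - {q})"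
      using in_B A(2) B(2) edges unfolding attachment_pair_def by blast
    obtain c where c: "c \<in> {a, b}" "c \<noteq> p" "perfectly_matched G (A - {c} - {p})"
      using A(1) pq(1) unfolding attachment_pair_def by (metis Diff_insert Diff_insert2)
    have "perfectly_matched G (A - {c} \<union> (B - {y}))"
      by (rule perfectly_matched_bridge[OF c(3) pq(5)]) (use c(2) pq disj in auto)
    moreover have "A \<union> B - {y} - {c} = A - {c} \<union> (B - {y})" "c \<noteq> y"
      using in_B mem_A[OF c(1)] disj by auto
    ultimately show ?thesis
      using c(1) by metis
  qed
qed

lemma extendable_join_extendable:
  assumes A: "extendable G A" "attachment_pair G A u u'"
    and B: "extendable G B" "attachment_pair G B v v'"
    and disj: "A \<inter> B = {}" and edges: "{u, v} \<in> G" "{u', v'} \<in> G"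
  shows "extendable G (A \<union> B)"
  unfolding extendable_def
proof
  have perfect: "perfectly_matched G A" "perfectly_matched G B"
    using A B unfolding extendable_def by auto
  then show "perfectly_matched G (A \<union> B)"
    using disj by (rule perfectly_matched_Un)
  have sym: "{v, u} \<in> G" "{v', u'} \<in> G" "B \<inter> A = {}"
    using edges disj by (auto simp: insert_commute)
  have "\<exists>b. attachment_pair G (A \<union> B) a b" if "a \<in> A" for a
    using A(1) that attachment_pair_join_extendable[OF _ A(2) perfect(2) B(2) disj edges]
    unfolding extendable_def by blast
  moreover have "\<exists>b. attachment_pair G (A \<union> B) a b" if "a \<in> B" for a
    using B(1) that attachment_pair_join_extendable[OF _ B(2) perfect(1) A(2) sym(3,1,2)]
    unfolding extendable_def Un_commute[of B A] by blast
  ultimately show "\<forall>a\<in>A \<union> B. \<exists>b. attachment_pair G (A \<union> B) a b"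
    by blast
qed

lemma factor_critical_join_extendable:
  assumes A: "factor_critical G A" and B: "extendable G B" "attachment_pair G B a b"
    and disj: "A \<inter> B = {}" and x: "x \<in> A" "{x, a} \<in> G" "{x, b} \<in> G"
  shows "factor_critical G (A \<union> B)"
  unfolding factor_critical_def
proof
  fix y assume "y \<in> A \<union> B"
  then consider (in_A) "y \<in> A" | (in_B) "y \<in> B"
    by blast
  then show "perfectly_matched G (A \<union> B - {y})"
  proof cases
    case in_A
    then have "A \<union> B - {y} = (A - {y}) \<union> B" "(A - {y}) \<inter> B = {}"
      using disj by auto
    then show ?thesis
      using in_A A B(1) by (simp add: perfectly_matched_Un factor_critical_def extendable_def)
  next
    case in_B
    then obtain c where c: "c \<in> {a, b}" "c \<noteq> y" "perfectly_matched G (B - {y} - {c})"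
      using B(2) unfolding attachment_pair_def by blast
    have "perfectly_matched G (A \<union> (B - {y}))"
      by (rule perfectly_matched_bridge[OF _ c(3), of A x])
        (use A B(2) x c disj in \<open>auto simp: factor_critical_def attachment_pair_def\<close>)
    moreover have "A \<union> B - {y} = A \<union> (B - {y})"
      using in_B disj by blast
    ultimately show ?thesis
      by simp
  qed
qed

definition sound_block :: "'a set set \<Rightarrow> 'a set \<Rightarrow> bool" where
  "sound_block G B \<longleftrightarrow> (if even (card B) then extendable G B else factor_critical G B)"

lemma sound_block_mono: "sound_block G B \<Longrightarrow> G \<subseteq> H \<Longrightarrow> sound_block H B"
  using extendable_mono factor_critical_mono unfolding sound_block_def by metis

lemma sound_block_singleton: "sound_block G {v}"
  by (simp add: sound_block_def factor_critical_singleton)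

lemma sound_block_near_perfect:
  assumes "sound_block G B" "finite B" "card (B \<inter> X) \<le> card B mod 2"
  shows "\<exists>S\<subseteq>B - X. perfectly_matched G S \<and> card S = 2 * (card B div 2)"
proof (cases "even (card B)")
  case True
  then have "B \<inter> X = {}"
    using assms(2,3) by simp
  then show ?thesis
    using assms(1) True by (intro exI[of _ B]) (auto simp: sound_block_def extendable_def)
next
  case False
  then have "B \<noteq> {}" "\<forall>x\<in>B \<inter> X. \<forall>y\<in>B \<inter> X. x = y"
    using assms(2,3) card_le_Suc0_iff_eq[of "B \<inter> X"] by (auto simp: mod2_eq_if)
  then obtain c where c: "c \<in> B" "B \<inter> X \<subseteq> {c}"
    by (cases "B \<inter> X = {}") blast+
  then have "perfectly_matched G (B - {c})" "card (B - {c}) = 2 * (card B div 2)"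
    using assms(1,2) False by (auto simp: sound_block_def factor_critical_def elim: oddE)
  then show ?thesis
    using c by (intro exI[of _ "B - {c}"]) auto
qed

lemma sound_block_join_odd_odd:
  assumes "sound_block G A" "sound_block G B" "finite A" "finite B" "odd (card A)" "odd (card B)"
    and "A \<inter> B = {}" "u \<in> A" "v \<in> B" "{u, v} \<in> G"
  shows "sound_block G (A \<union> B)"
  using extendable_join_factor_critical[of G A B u v] assms by (simp add: sound_block_def card_Un_disjoint)

lemma sound_block_join_odd_even:
  assumes "sound_block G A" "sound_block G B" "finite A" "finite B" "odd (card A)" "even (card B)"
    and "A \<inter> B = {}" "u \<in> A" "attachment_pair G B v q" "{u, v} \<in> G" "{u, q} \<in> G"
  shows "sound_block G (A \<union> B)"
  using factor_critical_join_extendable[of G A B v q u] assms by (simp add: sound_block_def card_Un_disjoint)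

lemma sound_block_join_even_even:
  assumes "sound_block G A" "sound_block G B" "finite A" "finite B" "even (card A)" "even (card B)"
    and "A \<inter> B = {}" "attachment_pair G A u p" "attachment_pair G B v q" "{u, v} \<in> G" "{p, q} \<in> G"
  shows "sound_block G (A \<union> B)"
  using extendable_join_extendable[of G A u p B v q] assms by (simp add: sound_block_def card_Un_disjoint)

lemma obtain_attachment_pair:
  assumes "sound_block G B" "even (card B)" "a \<in> B"
  obtains b where "attachment_pair G B a b" "b \<in> B" "b \<noteq> a"
  using assms attachment_pair_neq unfolding sound_block_def extendable_def attachment_pair_def by metis

lemma sound_block_join_even:
  assumes sound: "sound_block G A" "sound_block G B" and fin: "finite A" "finite B"
    and even: "even (card B)" and disj: "A \<inter> B = {}" and uv: "u \<in> A" "v \<in> B"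
  obtains p q where "p \<in> A" "q \<in> B" "{p, q} \<noteq> {u, v}"
    "sound_block (insert {p, q} (insert {u, v} G)) (A \<union> B)"
proof -
  obtain q where q: "attachment_pair G B v q" "q \<in> B" "q \<noteq> v"
    using obtain_attachment_pair[OF sound(2) even uv(2)] .
  have sound_insert: "sound_block (insert f (insert e G)) A" "sound_block (insert f (insert e G)) B" for e f
    by (rule sound_block_mono[OF sound(1)], blast) (rule sound_block_mono[OF sound(2)], blast)
  have attach_insert: "attachment_pair (insert f (insert e G)) C x y" if "attachment_pair G C x y" for C x y e f
    by (rule attachment_pair_mono[OF that]) blast
  show thesis
  proof (cases "even (card A)")
    case False
    have "sound_block (insert {u, q} (insert {u, v} G)) (A \<union> B)"
      using fin False even disj uv(1) attach_insert[OF q(1)]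
      by (rule sound_block_join_odd_even[OF sound_insert]) auto
    moreover have "{u, q} \<noteq> {u, v}"
      using \<open>q \<noteq> v\<close> by (auto simp: doubleton_eq_iff)
    ultimately show thesis
      using that uv(1) q(2) by blast
  next
    case True
    obtain p where p: "attachment_pair G A u p" "p \<in> A" "p \<noteq> u"
      using obtain_attachment_pair[OF sound(1) True uv(1)] .
    have "sound_block (insert {p, q} (insert {u, v} G)) (A \<union> B)"
      using fin True even disj attach_insert[OF p(1)] attach_insert[OF q(1)]
      by (rule sound_block_join_even_even[OF sound_insert]) auto
    moreover have "{p, q} \<noteq> {u, v}"
      using p(3) q(2) disj uv by (auto simp: doubleton_eq_iff)
    ultimately show thesis
      using that p(2) q(2) by blast
  qed
qed

section \<open>Partitions into blocks\<close>

definition block_pairs :: "'a set set \<Rightarrow> 'a set set" where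
  "block_pairs P = (\<Union>B\<in>P. [B]\<^bsup>2\<^esup>)"

definition block_matching_number :: "'a set set \<Rightarrow> nat" where
  "block_matching_number P = (\<Sum>B\<in>P. card B div 2)"

definition has_even_block :: "'a set set \<Rightarrow> bool" where
  "has_even_block P \<longleftrightarrow> (\<exists>B\<in>P. even (card B))"

definition merge :: "'a set set \<Rightarrow> 'a set \<Rightarrow> 'a set \<Rightarrow> 'a set set" where
  "merge P A B = insert (A \<union> B) (P - {A, B})"

lemma block_matching_number_singletons [simp]: "block_matching_number ((\<lambda>v. {v}) ` V) = 0"
  unfolding block_matching_number_def by (intro sum.neutral) auto

lemma block_pairs_subset_merge: "block_pairs P \<subseteq> block_pairs (merge P A B)"
proof
  fix e assume "e \<in> block_pairs P"
  then obtain C where "C \<in> P" "e \<in> [C]\<^bsup>2\<^esup>"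
    by (auto simp: block_pairs_def)
  then show "e \<in> block_pairs (merge P A B)"
    by (cases "C \<in> {A, B}") (auto simp: block_pairs_def merge_def nsets_def)
qed

lemma even_choose_2: "even (m choose 2) \<longleftrightarrow> even (m div 2)"
proof (cases "even m")
  case True
  then obtain b where "m = 2 * b"
    by blast
  then show ?thesis
    by (cases b) (simp_all add: choose_two)
next
  case False
  then obtain b where "m = 2 * b + 1"
    by (blast elim: oddE)
  then show ?thesis
    by (simp add: choose_two)
qed

locale finite_partition =
  fixes V :: "'a set" and P :: "'a set set"
  assumes finite_V: "finite V" and partition: "partition_on V P"
begin

lemma finite_P: "finite P"
  using finite_elements[OF finite_V partition] .

lemma block_subset: "B \<in> P \<Longrightarrow> B \<subseteq> V"
  using partition_onD1[OF partition] by blast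

lemma finite_block: "B \<in> P \<Longrightarrow> finite B"
  using block_subset finite_V finite_subset by blast

lemma block_nonempty: "B \<in> P \<Longrightarrow> B \<noteq> {}"
  using partition_onD3[OF partition] by blast

lemma block_disjoint: "A \<in> P \<Longrightarrow> B \<in> P \<Longrightarrow> A \<noteq> B \<Longrightarrow> A \<inter> B = {}"
  using disjointD[OF partition_onD2[OF partition]] by blast

lemma card_Un_blocks: "A \<in> P \<Longrightarrow> B \<in> P \<Longrightarrow> A \<noteq> B \<Longrightarrow> card (A \<union> B) = card A + card B"
  by (simp add: card_Un_disjoint finite_block block_disjoint)

lemma block_pairs_subset: "block_pairs P \<subseteq> [V]\<^bsup>2\<^esup>"
  using nsets_mono[OF block_subset] unfolding block_pairs_def by blast

lemma card_block_pairs: "card (block_pairs P) = (\<Sum>B\<in>P. card B choose 2)"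
proof -
  have "[A]\<^bsup>2\<^esup> \<inter> [B]\<^bsup>2\<^esup> = {}" if "A \<in> P" "B \<in> P" "A \<noteq> B" for A B
  proof -
    have "[A]\<^bsup>2\<^esup> \<inter> [B]\<^bsup>2\<^esup> = [A \<inter> B]\<^bsup>2\<^esup>"
      by (auto simp: nsets_def)
    then show ?thesis
      using block_disjoint[OF that] by (simp add: nsets_empty_iff)
  qed
  then show ?thesis
    unfolding block_pairs_def
    by (subst card_UN_disjoint) (simp_all add: finite_P finite_imp_finite_nsets finite_block)
qed

lemma even_card_block_pairs: "even (card (block_pairs P)) \<longleftrightarrow> even (block_matching_number P)"
proof -
  have "even (\<Sum>B\<in>P. card B choose 2) \<longleftrightarrow> even (\<Sum>B\<in>P. card B div 2)"
    using finite_P by (induction P) (auto simp: even_choose_2)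
  then show ?thesis
    by (simp add: card_block_pairs block_matching_number_def)
qed

lemma card_block_pairs_le: "card (block_pairs P) \<le> (2 * block_matching_number P + 1) choose 2"
proof -
  let ?m = "block_matching_number P"
  have "card B choose 2 \<le> card B div 2 * (2 * ?m + 1)" if "B \<in> P" for B
  proof -
    let ?b = "card B div 2"
    have "card B choose 2 \<le> (2 * ?b + 1) choose 2"
      by (rule binomial_right_mono) simp
    also have "\<dots> = ?b * (2 * ?b + 1)"
      by (simp add: choose_two)
    also have "?b \<le> ?m"
      unfolding block_matching_number_def using finite_P that by (intro member_le_sum) auto
    then have "?b * (2 * ?b + 1) \<le> ?b * (2 * ?m + 1)"
      by simp
    finally show ?thesis .
  qed
  then have "card (block_pairs P) \<le> (\<Sum>B\<in>P. card B div 2 * (2 * ?m + 1))"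
    unfolding card_block_pairs by (rule sum_mono)
  also have "\<dots> = ?m * (2 * ?m + 1)"
    by (simp only: block_matching_number_def sum_distrib_right)
  also have "\<dots> = (2 * ?m + 1) choose 2"
    by (simp add: choose_two)
  finally show ?thesis .
qed

lemma card_odd_blocks: "card V = 2 * block_matching_number P + card {B\<in>P. odd (card B)}"
proof -
  have "card V = sum card P"
    using partition_onD1[OF partition] partition_onD2[OF partition] finite_block
    by (simp add: card_Union_disjoint)
  also have "\<dots> = (\<Sum>B\<in>P. 2 * (card B div 2) + (if odd (card B) then 1 else 0))"
    by (intro sum.cong) (auto elim: oddE)
  also have "\<dots> = 2 * block_matching_number P + card {B\<in>P. odd (card B)}"
    using finite_P by (simp add: sum.distrib sum_distrib_left block_matching_number_def sum.If_cases Int_def)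
  finally show ?thesis .
qed

lemma obtain_odd_block_neq:
  assumes "2 * block_matching_number P + 2 \<le> card V"
  obtains A where "A \<in> P" "odd (card A)" "A \<noteq> C"
proof -
  have "\<not> {B\<in>P. odd (card B)} \<subseteq> {C}"
    using card_odd_blocks assms card_mono[of "{C}" "{B\<in>P. odd (card B)}"] by auto
  then show thesis
    using that by blast
qed

lemma matching_number_le_block_matching_number:
  assumes "G \<subseteq> block_pairs P"
  shows "matching_number G \<le> block_matching_number P"
proof -
  have "finite G"
    using assms block_pairs_subset finite_imp_finite_nsets[OF finite_V] finite_subset by metis
  then obtain M where M: "M \<in> matchings G" "card M = matching_number G"
    by (rule obtain_maximum_matching)
  then have "M = (\<Union>B\<in>P. M \<inter> [B]\<^bsup>2\<^esup>)"
    using assms by (auto simp: matchings_def block_pairs_def)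
  then have "card M \<le> (\<Sum>B\<in>P. card (M \<inter> [B]\<^bsup>2\<^esup>))"
    using card_UN_le[OF finite_P, of "\<lambda>B. M \<inter> [B]\<^bsup>2\<^esup>"] by simp
  also have "\<dots> \<le> (\<Sum>B\<in>P. card B div 2)"
  proof (rule sum_mono)
    fix B assume "B \<in> P"
    have "M \<inter> [B]\<^bsup>2\<^esup> \<in> matchings ([B]\<^bsup>2\<^esup>)"
      using M(1) by (auto simp: matchings_def intro: pairwise_subset)
    then have "card (M \<inter> [B]\<^bsup>2\<^esup>) \<le> matching_number ([B]\<^bsup>2\<^esup>)"
      using card_le_matching_number finite_imp_finite_nsets finite_block[OF \<open>B \<in> P\<close>] by blast
    then show "card (M \<inter> [B]\<^bsup>2\<^esup>) \<le> card B div 2"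
      using twice_matching_number_le[OF finite_block[OF \<open>B \<in> P\<close>] order_refl] by linarith
  qed
  finally show ?thesis
    using M(2) by (simp add: block_matching_number_def)
qed

lemma pair_cases [consumes 1, case_names within across]:
  assumes "e \<in> [V]\<^bsup>2\<^esup>"
  obtains B where "B \<in> P" "e \<in> [B]\<^bsup>2\<^esup>"
    | A B u v where "A \<in> P" "B \<in> P" "A \<noteq> B" "u \<in> A" "v \<in> B" "e = {u, v}"
      "even (card A) \<Longrightarrow> even (card B)"
proof -
  obtain u v where uv: "e = {u, v}" "u \<in> V" "v \<in> V" "u \<noteq> v"
    using assms by (rule nsets2_E)
  then obtain A B where AB: "A \<in> P" "B \<in> P" "u \<in> A" "v \<in> B"
    using partition_onD1[OF partition] by blast
  show thesis
  proof (cases "A = B")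
    case True
    then show thesis
      using that(1)[of A] AB uv by simp
  next
    case False
    moreover have "e = {v, u}"
      using uv(1) by auto
    ultimately show thesis
      using that(2)[of A B u v] that(2)[of B A v u] AB uv(1) by blast
  qed
qed

context
  fixes A B
  assumes AB: "A \<in> P" "B \<in> P" "A \<noteq> B"
begin

lemma finite_partition_merge: "finite_partition V (merge P A B)"
proof
  show "partition_on V (merge P A B)"
  proof (rule partition_onI)
    show "\<Union>(merge P A B) = V"
      using partition_onD1[OF partition] AB by (auto simp: merge_def)
    show "{} \<notin> merge P A B"
      using block_nonempty AB by (auto simp: merge_def)
    have "disjnt (A \<union> B) C" if "C \<in> P - {A, B}" for C
      using that block_disjoint AB by (auto simp: disjnt_def)
    then show "disjnt C D" if "C \<in> merge P A B" "D \<in> merge P A B" "C \<noteq> D" for C D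
      using that block_disjoint disjnt_sym unfolding merge_def disjnt_def by blast
  qed
qed (rule finite_V)

lemma block_matching_number_merge:
  "block_matching_number (merge P A B) =
    block_matching_number P + (if odd (card A) \<and> odd (card B) then 1 else 0)"
proof -
  have "A \<union> B \<notin> P - {A, B}"
    using block_disjoint[of "A \<union> B" A] AB block_nonempty[OF AB(1)] by blast
  then have "block_matching_number (merge P A B) =
      (card A + card B) div 2 + (\<Sum>C\<in>P - {A, B}. card C div 2)"
    using finite_P AB by (simp add: block_matching_number_def merge_def card_Un_blocks)
  moreover have "block_matching_number P =
      card A div 2 + card B div 2 + (\<Sum>C\<in>P - {A, B}. card C div 2)"
    using sum.subset_diff[of "{A, B}" P "\<lambda>C. card C div 2"] finite_P AB
    by (simp add: block_matching_number_def)
  moreover have "(card A + card B) div 2 =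
      card A div 2 + card B div 2 + (if odd (card A) \<and> odd (card B) then 1 else 0)"
    by (auto elim!: evenE oddE)
  ultimately show ?thesis
    by simp
qed

lemma has_even_block_merge: "even (card A) = even (card B) \<Longrightarrow> has_even_block (merge P A B)"
  using card_Un_blocks[OF AB] by (auto simp: has_even_block_def merge_def)

end

end

section \<open>Graphs with a block structure\<close>

locale block_structure = finite_partition V P for V :: "'a set" and P +
  fixes G :: "'a set set"
  assumes edges_in_blocks: "G \<subseteq> block_pairs P"
    and sound: "B \<in> P \<Longrightarrow> sound_block G B"

lemma block_structure_singletons:
  "finite V \<Longrightarrow> block_structure V ((\<lambda>v. {v}) ` V) {}"
  by unfold_locales (auto simp: partition_on_singletons sound_block_singleton)

context block_structure
begin

lemma edges_subset: "G \<subseteq> [V]\<^bsup>2\<^esup>"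
  using edges_in_blocks block_pairs_subset by blast

lemma finite_edges: "finite G"
  using finite_subset[OF edges_subset finite_imp_finite_nsets[OF finite_V]] .

lemma obtain_matching_avoiding:
  assumes X: "\<And>B. B \<in> P \<Longrightarrow> card (B \<inter> X) \<le> card B mod 2"
  obtains M where "M \<in> matchings G" "card M = block_matching_number P" "\<Union>M \<inter> X = {}"
proof -
  have "\<exists>S\<subseteq>B - X. perfectly_matched G S \<and> card S = 2 * (card B div 2)" if "B \<in> P" for B
    using sound_block_near_perfect[OF sound finite_block X, OF that that that] .
  then obtain S where S: "S B \<subseteq> B - X" "perfectly_matched G (S B)" "card (S B) = 2 * (card B div 2)"
    if "B \<in> P" for B
    by metis
  have "disjoint_family_on S P"
    using S(1) block_disjoint unfolding disjoint_family_on_def by blast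
  then have "perfectly_matched G (\<Union>B\<in>P. S B)"
    using finite_P S(2) perfectly_matched_UN by blast
  then obtain M where M: "M \<in> matchings G" "\<Union>M = (\<Union>B\<in>P. S B)"
    unfolding perfectly_matched_def by blast
  have "2 * card M = card (\<Union>B\<in>P. S B)"
    using card_Union_matching[OF M(1) edges_subset] M(2) by simp
  also have "\<dots> = (\<Sum>B\<in>P. card (S B))"
    using S(1) finite_block finite_P finite_subset \<open>disjoint_family_on S P\<close>
    by (intro card_UN_disjoint') blast+
  also have "\<dots> = 2 * block_matching_number P"
    using S(3) by (simp add: block_matching_number_def sum_distrib_left)
  finally have "card M = block_matching_number P"
    by simp
  moreover have "\<Union>M \<inter> X = {}"
    using M(2) S(1) by blast
  ultimately show thesis
    using that M(1) by blast
qed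

lemma matching_number_eq: "matching_number G = block_matching_number P"
proof (rule antisym)
  show "matching_number G \<le> block_matching_number P"
    using edges_in_blocks by (rule matching_number_le_block_matching_number)
  obtain M where "M \<in> matchings G" "card M = block_matching_number P"
    by (rule obtain_matching_avoiding[of "{}"]) auto
  then show "block_matching_number P \<le> matching_number G"
    using card_le_matching_number[OF finite_edges] by metis
qed

lemma insert_within_block:
  assumes "B \<in> P" "e \<in> [B]\<^bsup>2\<^esup>"
  shows "block_structure V P (insert e G)"
proof
  show "insert e G \<subseteq> block_pairs P"
    using assms edges_in_blocks by (auto simp: block_pairs_def)
qed (use sound sound_block_mono in blast)

context
  fixes A B
  assumes AB: "A \<in> P" "B \<in> P" "A \<noteq> B"
begin

lemma cross_pair:
  assumes "u \<in> A" "v \<in> B"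
  shows "{u, v} \<in> [V]\<^bsup>2\<^esup>" "{u, v} \<in> [A \<union> B]\<^bsup>2\<^esup>" "{u, v} \<notin> G"
proof -
  have "u \<noteq> v"
    using assms block_disjoint[OF AB] by blast
  then show "{u, v} \<in> [V]\<^bsup>2\<^esup>" "{u, v} \<in> [A \<union> B]\<^bsup>2\<^esup>"
    using assms AB block_subset by auto
  show "{u, v} \<notin> G"
  proof
    assume "{u, v} \<in> G"
    then obtain C where "C \<in> P" "u \<in> C" "v \<in> C"
      using edges_in_blocks by (auto simp: block_pairs_def)
    then show False
      using block_disjoint AB assms by blast
  qed
qed

lemma subset_block_pairs_merge:
  assumes "H - G \<subseteq> [A \<union> B]\<^bsup>2\<^esup>"
  shows "H \<subseteq> block_pairs (merge P A B)"
proof -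
  have "[A \<union> B]\<^bsup>2\<^esup> \<subseteq> block_pairs (merge P A B)"
    by (auto simp: block_pairs_def merge_def)
  then show ?thesis
    using assms edges_in_blocks block_pairs_subset_merge by blast
qed

lemma block_structure_merge:
  assumes "G \<subseteq> H" "H - G \<subseteq> [A \<union> B]\<^bsup>2\<^esup>" "sound_block H (A \<union> B)"
  shows "block_structure V (merge P A B) H"
proof -
  interpret merged: finite_partition V "merge P A B"
    using finite_partition_merge[OF AB] .
  show ?thesis
  proof
    show "H \<subseteq> block_pairs (merge P A B)"
      using assms(2) by (rule subset_block_pairs_merge)
    show "sound_block H C" if "C \<in> merge P A B" for C
      using that assms(3) sound_block_mono[OF sound assms(1)] by (auto simp: merge_def)
  qed
qed

lemma matching_number_insert_across:
  assumes "u \<in> A" "v \<in> B"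
  shows "matching_number (insert {u, v} G) \<le> block_matching_number (merge P A B)"
proof -
  interpret merged: finite_partition V "merge P A B"
    using finite_partition_merge[OF AB] .
  have "insert {u, v} G - G \<subseteq> [A \<union> B]\<^bsup>2\<^esup>"
    using cross_pair(2)[OF assms] by blast
  then show ?thesis
    by (intro merged.matching_number_le_block_matching_number subset_block_pairs_merge)
qed

lemma block_structure_join_odd_odd:
  assumes "odd (card A)" "odd (card B)" "u \<in> A" "v \<in> B"
  shows "block_structure V (merge P A B) (insert {u, v} G)"
proof (rule block_structure_merge)
  show "sound_block (insert {u, v} G) (A \<union> B)"
    using AB assms block_disjoint finite_block sound_block_mono[OF sound subset_insertI]
    by (intro sound_block_join_odd_odd) auto
qed (use cross_pair(2)[OF assms(3,4)] in auto)

lemma block_structure_join_even: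
  assumes "even (card B)" "u \<in> A" "v \<in> B"
  obtains p q where "p \<in> A" "q \<in> B" "{p, q} \<noteq> {u, v}"
    "block_structure V (merge P A B) (insert {p, q} (insert {u, v} G))"
proof -
  obtain p q where pq: "p \<in> A" "q \<in> B" "{p, q} \<noteq> {u, v}"
      and "sound_block (insert {p, q} (insert {u, v} G)) (A \<union> B)"
    using sound_block_join_even[OF sound sound finite_block finite_block assms(1) block_disjoint] AB assms
    by metis
  moreover have "insert {p, q} (insert {u, v} G) - G \<subseteq> [A \<union> B]\<^bsup>2\<^esup>"
    using cross_pair(2) pq assms by blast
  ultimately have "block_structure V (merge P A B) (insert {p, q} (insert {u, v} G))"
    by (intro block_structure_merge) auto
  then show thesis
    using that pq by blast
qed

end

lemma pinned_by_two_odd_blocks: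
  assumes A: "A \<in> P" "odd (card A)" "x \<in> A" and C: "C \<in> P" "odd (card C)" "y \<in> C" "C \<noteq> A"
    and B: "B \<in> P" "even (card B)" "a \<in> B"
  defines "H \<equiv> insert {y, a} (insert {x, a} G)"
  shows "pinned H a" "matching_number H = matching_number G"
proof -
  have "A \<noteq> B" "C \<noteq> B"
    using A C B by auto
  have "x \<noteq> y"
    using block_disjoint A C by blast
  have "matching_number H = max (matching_number (insert {y, a} G)) (matching_number (insert {x, a} G))"
    unfolding H_def by (rule matching_number_insert_intersecting[OF finite_edges]) blast
  also have "\<dots> \<le> block_matching_number P"
    using matching_number_insert_across[OF A(1) B(1) \<open>A \<noteq> B\<close> A(3) B(3)]
      matching_number_insert_across[OF C(1) B(1) \<open>C \<noteq> B\<close> C(3) B(3)]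
      block_matching_number_merge A C B \<open>A \<noteq> B\<close> \<open>C \<noteq> B\<close> by simp
  finally show eq: "matching_number H = matching_number G"
    using matching_number_mono[of H G] finite_edges matching_number_eq by (fastforce simp: H_def)
  have "card (D \<inter> {x, y}) \<le> card D mod 2" if "D \<in> P" for D
  proof -
    have "D \<inter> {x, y} = (if D = A then {x} else if D = C then {y} else {})"
      using block_disjoint[OF that A(1)] block_disjoint[OF that C(1)] block_disjoint[OF A(1) C(1)] A C
      by auto
    then show ?thesis
      using A(2) C(2) by (simp add: odd_iff_mod_2_eq_one)
  qed
  then obtain M where M: "M \<in> matchings G" "card M = block_matching_number P" "\<Union>M \<inter> {x, y} = {}"
    using obtain_matching_avoiding by metis
  then have "M \<in> matchings H" "card M = matching_number H"
    using matching_number_eq eq by (auto simp: matchings_def H_def)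
  then show "pinned H a"
    using M(3) \<open>x \<noteq> y\<close> unfolding pinned_def H_def by (auto simp: insert_commute)
qed

end

section \<open>Positions of the matching game\<close>

lemma pairs_eq_nsets: "pairs n = [{1..n}]\<^bsup>2\<^esup>"
  by (auto simp: pairs_def nsets_def intro: finite_subset)

lemma matching_property_iff:
  assumes "G \<subseteq> pairs n"
  shows "G \<in> matching_property n k \<longleftrightarrow> k \<le> matching_number G"
proof
  have "finite G"
    using assms finite_pairs finite_subset by blast
  show "k \<le> matching_number G" if "G \<in> matching_property n k"
    using that card_le_matching_number[OF \<open>finite G\<close>]
    by (auto simp: matching_property_def matching_def matchings_def)
  assume "k \<le> matching_number G"
  then obtain M where "M \<in> matchings G" "k \<le> card M"
    using obtain_maximum_matching[OF \<open>finite G\<close>] by metis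
  moreover from this obtain M' where "M' \<subseteq> M" "card M' = k"
    using obtain_subset_with_card_n by metis
  ultimately have "M' \<in> matchings G" "card M' = k"
    using matchings_subset by auto
  then show "G \<in> matching_property n k"
    using assms by (auto simp: matching_property_def matching_def matchings_def)
qed

abbreviation legal_moves :: "nat \<Rightarrow> nat \<Rightarrow> graph \<Rightarrow> graph" where
  "legal_moves n k \<equiv> legal_edges n (matching_property n k)"

abbreviation final_size :: "nat \<Rightarrow> nat \<Rightarrow> player \<Rightarrow> graph \<Rightarrow> nat" where
  "final_size n k \<equiv> game_value n (matching_property n k)"

lemma legal_moves_eq:
  assumes "G \<subseteq> pairs n"
  shows "legal_moves n k G = {e \<in> pairs n - G. matching_number (insert e G) < k}"
  using assms matching_property_iff[of "insert _ G" n k] by (auto simp: legal_edges_def)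

lemma final_size_few_vertices:
  assumes "n < 2 * k"
  shows "final_size n k p {} = n choose 2"
proof (rule game_value_invariant[where Q = "\<lambda>G. G \<subseteq> pairs n" and R = "\<lambda>s. s = n choose 2"])
  fix G assume G: "G \<subseteq> pairs n" and final: "legal_moves n k G = {}"
  have "matching_number H < k" if "H \<subseteq> pairs n" for H
    using twice_matching_number_le[of "{1..n}" H] that assms by (simp add: pairs_eq_nsets)
  then have "G = pairs n"
    using G final by (auto simp: legal_moves_eq)
  then show "card G = n choose 2"
    by (simp add: pairs_eq_nsets)
qed (auto simp: legal_edges_def)

lemma card_ge_final_pinned:
  assumes G: "G \<subseteq> pairs n" "pinned G a" "matching_number G < k" and final: "legal_moves n k G = {}"
  shows "n - 1 \<le> card G"
proof -
  have "finite G"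
    using G(1) finite_pairs finite_subset by blast
  have "a \<in> {1..n}"
    using G(1,2) by (auto simp: pinned_def pairs_eq_nsets)
  have "{a, w} \<in> G" if "w \<in> {1..n} - {a}" for w
  proof (rule ccontr)
    assume "{a, w} \<notin> G"
    moreover have "{a, w} \<in> pairs n"
      using that \<open>a \<in> {1..n}\<close> by (simp add: pairs_eq_nsets)
    moreover have "matching_number (insert {a, w} G) = matching_number G"
      using matching_number_insert_at_pinned[OF \<open>finite G\<close> _ G(2)] G(1) by (simp add: pairs_eq_nsets)
    ultimately have "{a, w} \<in> legal_moves n k G"
      using G(1,3) by (simp add: legal_moves_eq)
    then show False
      using final by blast
  qed
  then have "card ({1..n} - {a}) \<le> card G"
    by (rule card_ge_universal_vertex[OF \<open>finite G\<close>])
  then show ?thesis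
    using \<open>a \<in> {1..n}\<close> by simp
qed

lemma final_size_pinned:
  assumes "G \<subseteq> pairs n" "pinned G a" "Suc (matching_number G) = k"
  shows "n - 1 \<le> final_size n k p G"
proof (rule game_value_invariant[where R = "\<lambda>s. n - 1 \<le> s"
      and Q = "\<lambda>G. G \<subseteq> pairs n \<and> pinned G a \<and> Suc (matching_number G) = k"])
  fix G e
  assume G: "G \<subseteq> pairs n \<and> pinned G a \<and> Suc (matching_number G) = k"
    and "e \<in> legal_moves n k G"
  then have e: "e \<in> pairs n" "matching_number (insert e G) < k"
    by (auto simp: legal_moves_eq)
  have "finite G"
    using G finite_pairs finite_subset by blast
  then have "matching_number (insert e G) = matching_number G"
    using matching_number_mono[of "insert e G" G] G e(2) by fastforce
  then show "insert e G \<subseteq> pairs n \<and> pinned (insert e G) a \<and> Suc (matching_number (insert e G)) = k"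
    using G e(1) pinned_mono[of G a "insert e G"] by auto
next
  fix G
  assume "G \<subseteq> pairs n \<and> pinned G a \<and> Suc (matching_number G) = k" and "legal_moves n k G = {}"
  then show "n - 1 \<le> card G"
    using card_ge_final_pinned[of G n a k] by auto
qed (use assms in simp)

definition mergeable :: "nat \<Rightarrow> nat set set \<Rightarrow> bool" where
  "mergeable k P \<longleftrightarrow> Suc (block_matching_number P) < k \<or> has_even_block P"

text \<open>The only moves that can leave Max without an even block at matching number \<open>k - 1\<close>.\<close>

definition tight_odd_even_join :: "nat \<Rightarrow> nat set set \<Rightarrow> nat set \<Rightarrow> bool" where
  "tight_odd_even_join k P e \<longleftrightarrow> Suc (block_matching_number P) = k \<and>
    (\<exists>A\<in>P. \<exists>B\<in>P. \<exists>x\<in>A. \<exists>a\<in>B. odd (card A) \<and> even (card B) \<and> e = {x, a})"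

locale structured_position = block_structure "{1..n}" P G for n k :: nat and P G +
  assumes matching_number_less: "matching_number G < k" and enough_vertices: "2 * k \<le> n"

lemma structured_move:
  assumes "block_structure {1..n} P (insert e G)" "block_matching_number P < k" "2 * k \<le> n" "e \<notin> G"
  shows "e \<in> legal_moves n k G" "structured_position n k P (insert e G)"
proof -
  interpret block_structure "{1..n}" P "insert e G"
    by fact
  have less: "matching_number (insert e G) < k"
    using matching_number_eq assms(2) by simp
  then show "e \<in> legal_moves n k G"
    using edges_subset assms(4) by (simp add: legal_moves_eq pairs_eq_nsets)
  show "structured_position n k P (insert e G)"
    by unfold_locales (fact less, fact assms(3))
qed

definition structured_for :: "player \<Rightarrow> nat \<Rightarrow> nat \<Rightarrow> graph \<Rightarrow> bool" where
  "structured_for p n k G \<longleftrightarrow>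
    (\<exists>P. structured_position n k P G \<and> (p = player.Max \<longrightarrow> mergeable k P))"

context structured_position
begin

lemma subset_pairs: "G \<subseteq> pairs n"
  using edges_subset by (simp add: pairs_eq_nsets)

lemma block_matching_number_less: "block_matching_number P < k"
  using matching_number_less matching_number_eq by simp

lemma legal_move_iff:
  "e \<in> legal_moves n k G \<longleftrightarrow> e \<in> pairs n \<and> e \<notin> G \<and> matching_number (insert e G) < k"
  using subset_pairs by (simp add: legal_moves_eq)

lemma obtain_other_odd_block:
  obtains A where "A \<in> P" "odd (card A)" "A \<noteq> C"
  using obtain_odd_block_neq[of C] block_matching_number_less enough_vertices by auto

text \<open>
  If every block is complete, the number of edges has the parity of the matching number.
  Hence the player who has to move with the wrong parity for \<open>k - 1\<close> can either add an edge inside a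
  block or raise the matching number.
\<close>

lemma tempo_move:
  assumes parity: "even (card G + k)" and mergeable: "p = player.Max \<longrightarrow> mergeable k P"
  shows "\<exists>f\<in>legal_moves n k G. structured_for p n k (insert f G)"
proof (cases "G = block_pairs P")
  case False
  then obtain f B where f: "f \<notin> G" "B \<in> P" "f \<in> [B]\<^bsup>2\<^esup>"
    using edges_in_blocks by (auto simp: block_pairs_def)
  show ?thesis
    using structured_move[OF insert_within_block[OF f(2,3)] block_matching_number_less enough_vertices f(1)]
      mergeable unfolding structured_for_def by blast
next
  case True
  then have "even (block_matching_number P + k)"
    using parity even_card_block_pairs by simp
  then have "Suc (block_matching_number P) < k"
    using block_matching_number_less by (cases "Suc (block_matching_number P) = k") auto
  obtain A where A: "A \<in> P" "odd (card A)"
    using obtain_other_odd_block by blast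
  obtain B where B: "B \<in> P" "odd (card B)" "A \<noteq> B"
    using obtain_other_odd_block by metis
  obtain u v where uv: "u \<in> A" "v \<in> B"
    using A B block_nonempty by blast
  have "block_matching_number (merge P A B) < k"
    using block_matching_number_merge[OF A(1) B(1,3)] A B \<open>Suc _ < k\<close> by simp
  from structured_move[OF block_structure_join_odd_odd[OF A(1) B(1,3) A(2) B(2) uv] this enough_vertices]
  show ?thesis
    using cross_pair(3)[OF A(1) B(1,3) uv] has_even_block_merge[OF A(1) B(1,3)] A(2) B(2)
    unfolding structured_for_def mergeable_def by blast
qed

lemma tempo_reply:
  assumes parity: "odd (card G + k)" and e: "e \<in> legal_moves n k G"
    and Q: "block_structure {1..n} Q (insert e G)" "p = player.Max \<longrightarrow> mergeable k Q"
  shows "\<exists>f\<in>legal_moves n k (insert e G). structured_for p n k (insert f (insert e G))"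
proof -
  interpret new: block_structure "{1..n}" Q "insert e G"
    by fact
  have "e \<notin> G" "matching_number (insert e G) < k"
    using e by (simp_all add: legal_move_iff)
  interpret new: structured_position n k Q "insert e G"
    by unfold_locales (fact \<open>matching_number (insert e G) < k\<close>, fact enough_vertices)
  have "even (card (insert e G) + k)"
    using parity \<open>e \<notin> G\<close> finite_edges by simp
  then show ?thesis
    using new.tempo_move Q(2) by blast
qed

lemma reply_to_even_join:
  assumes AB: "A \<in> P" "B \<in> P" "A \<noteq> B" "even (card B)" and uv: "u \<in> A" "v \<in> B"
    and mergeable: "p = player.Max \<longrightarrow> mergeable k P \<and> \<not> tight_odd_even_join k P {u, v}"
  shows "\<exists>f\<in>legal_moves n k (insert {u, v} G). structured_for p n k (insert f (insert {u, v} G))"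
proof -
  obtain x y where xy: "x \<in> A" "y \<in> B" "{x, y} \<noteq> {u, v}"
      "block_structure {1..n} (merge P A B) (insert {x, y} (insert {u, v} G))"
    using block_structure_join_even[OF AB uv] .
  have unchanged: "block_matching_number (merge P A B) = block_matching_number P"
    using block_matching_number_merge[OF AB(1-3)] AB(4) by simp
  have "{x, y} \<notin> insert {u, v} G"
    using cross_pair(3)[OF AB(1-3) xy(1,2)] xy(3) by simp
  moreover have "block_matching_number (merge P A B) < k"
    using unchanged block_matching_number_less by simp
  moreover have "mergeable k (merge P A B)" if "p = player.Max"
  proof (cases "Suc (block_matching_number P) < k")
    case True
    then show ?thesis
      using unchanged by (simp add: mergeable_def)
  next
    case False
    then have "Suc (block_matching_number P) = k"
      using block_matching_number_less by simp
    then have "even (card A)"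
      using that mergeable AB uv unfolding tight_odd_even_join_def by blast
    then show ?thesis
      using has_even_block_merge[OF AB(1-3)] AB(4) by (simp add: mergeable_def)
  qed
  ultimately show ?thesis
    using structured_move[OF xy(4) _ enough_vertices] unfolding structured_for_def by blast
qed

lemma reply_move:
  assumes parity: "odd (card G + k)" and e: "e \<in> legal_moves n k G"
    and mergeable: "p = player.Max \<longrightarrow> mergeable k P \<and> \<not> tight_odd_even_join k P e"
  shows "\<exists>f\<in>legal_moves n k (insert e G). structured_for p n k (insert f (insert e G))"
proof -
  have "e \<in> [{1..n}]\<^bsup>2\<^esup>"
    using e legal_move_iff by (simp add: pairs_eq_nsets)
  then show ?thesis
  proof (cases rule: pair_cases)
    case (within B)
    then show ?thesis
      using tempo_reply[OF parity e insert_within_block] mergeable by blast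
  next
    case (across A B u v)
    show ?thesis
    proof (cases "even (card B)")
      case True
      show ?thesis
        using reply_to_even_join[OF across(1-3) True across(4,5)] mergeable across(6) by simp
    next
      case False
      then have odd: "odd (card A)" "odd (card B)"
        using across(7) by auto
      have "block_structure {1..n} (merge P A B) (insert e G)"
        using block_structure_join_odd_odd[OF across(1-3) odd across(4,5)] across(6) by simp
      moreover have "mergeable k (merge P A B)"
        using has_even_block_merge[OF across(1-3)] odd by (simp add: mergeable_def)
      ultimately show ?thesis
        using tempo_reply[OF parity e] by blast
    qed
  qed
qed

lemma pinning_reply:
  assumes e: "e \<in> legal_moves n k G" "tight_odd_even_join k P e"
  shows "\<exists>f\<in>legal_moves n k (insert e G).
    n - 1 \<le> final_size n k p (insert f (insert e G))"
proof -
  obtain A B x a where A: "A \<in> P" "odd (card A)" "x \<in> A" and B: "B \<in> P" "even (card B)" "a \<in> B"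
    and e_eq: "e = {x, a}" and tight: "Suc (matching_number G) = k"
    using e(2) matching_number_eq unfolding tight_odd_even_join_def by metis
  obtain C where C: "C \<in> P" "odd (card C)" "C \<noteq> A"
    using obtain_other_odd_block .
  then obtain y where y: "y \<in> C"
    using block_nonempty by blast
  define H where "H = insert {y, a} (insert e G)"
  have H: "pinned H a" "matching_number H = matching_number G"
    using pinned_by_two_odd_blocks[OF A C(1,2) y C(3) B] by (simp_all add: H_def e_eq)
  have f: "{y, a} \<in> pairs n" "{y, a} \<notin> G"
    using cross_pair[OF C(1) B(1) _ y B(3)] C(2) B(2) by (auto simp: pairs_eq_nsets)
  moreover have "{y, a} \<noteq> e"
    using block_disjoint[OF A(1) C(1)] A(3) C(3) y by (auto simp: e_eq doubleton_eq_iff)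
  moreover have "insert e G \<subseteq> pairs n"
    using e(1) subset_pairs by (simp add: legal_move_iff)
  ultimately have "{y, a} \<in> legal_moves n k (insert e G)" "H \<subseteq> pairs n"
    using H(2) matching_number_less by (simp_all add: legal_moves_eq H_def)
  moreover have "n - 1 \<le> final_size n k p H"
    using final_size_pinned \<open>H \<subseteq> pairs n\<close> H tight by simp
  ultimately show ?thesis
    unfolding H_def by blast
qed

lemma mergeable_has_legal_move:
  assumes "mergeable k P"
  shows "legal_moves n k G \<noteq> {}"
proof -
  obtain A where A: "A \<in> P" "odd (card A)"
    using obtain_other_odd_block by blast
  obtain B where B: "B \<in> P" "A \<noteq> B" "block_matching_number (merge P A B) < k"
  proof (cases "Suc (block_matching_number P) < k")
    case True
    obtain B where "B \<in> P" "A \<noteq> B"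
      using obtain_other_odd_block by metis
    then show thesis
      using that block_matching_number_merge[OF A(1)] True by simp
  next
    case False
    then obtain B where "B \<in> P" "even (card B)"
      using assms by (auto simp: mergeable_def has_even_block_def)
    moreover from this have "A \<noteq> B"
      using A(2) by blast
    ultimately show thesis
      using that block_matching_number_merge[OF A(1)] block_matching_number_less by simp
  qed
  obtain u v where uv: "u \<in> A" "v \<in> B"
    using A B block_nonempty by blast
  have "{u, v} \<in> legal_moves n k G"
    using cross_pair[OF A(1) B(1,2) uv] matching_number_insert_across[OF A(1) B(1,2) uv] B(3)
    by (simp add: legal_move_iff pairs_eq_nsets)
  then show ?thesis
    by blast
qed

lemma card_edges_le: "card G \<le> (2 * k - 1) choose 2"
proof -
  have "card G \<le> card (block_pairs P)"
    using finite_subset[OF block_pairs_subset finite_imp_finite_nsets[OF finite_V]] edges_in_blocks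
    by (rule card_mono)
  also have "\<dots> \<le> (2 * block_matching_number P + 1) choose 2"
    by (rule card_block_pairs_le)
  also have "\<dots> \<le> (2 * k - 1) choose 2"
    using block_matching_number_less by (intro binomial_right_mono) simp
  finally show ?thesis .
qed

end

section \<open>The score of the matching game\<close>

fun score_bound :: "player \<Rightarrow> nat \<Rightarrow> nat \<Rightarrow> nat" where
  "score_bound player.Mini n k = (2 * k - 1) choose 2"
| "score_bound player.Max n k = n - 1"

definition favourable :: "player \<Rightarrow> nat \<Rightarrow> nat \<Rightarrow> graph \<Rightarrow> bool" where
  "favourable p n k G \<longleftrightarrow> odd (card G + k) \<and> structured_for p n k G"

lemma favourable_reply:
  assumes "favourable p n k G" and e: "e \<in> legal_moves n k G"
  shows "\<exists>f\<in>legal_moves n k (insert e G). favourable p n k (insert f (insert e G)) \<or>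
    prefers p (final_size n k (opponent p) (insert f (insert e G))) (score_bound p n k)"
proof -
  obtain P where P: "structured_position n k P G" "p = player.Max \<longrightarrow> mergeable k P"
    and parity: "odd (card G + k)"
    using assms(1) unfolding favourable_def structured_for_def by blast
  interpret structured_position n k P G
    by fact
  show ?thesis
  proof (cases "p = player.Max \<and> tight_odd_even_join k P e")
    case True
    then show ?thesis
      using pinning_reply[OF e, of player.Mini] by auto
  next
    case False
    then obtain f where f: "f \<in> legal_moves n k (insert e G)" "structured_for p n k (insert f (insert e G))"
      using reply_move[OF parity e] P(2) by blast
    moreover have "odd (card (insert f (insert e G)) + k)"
      using parity e f(1) finite_edges by (simp add: legal_edges_def)
    ultimately show ?thesis
      unfolding favourable_def by blast
  qed
qed

lemma favourable_value:
  assumes "favourable p n k G"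
  shows "prefers p (final_size n k (opponent p) G) (score_bound p n k)"
proof (rule strategy_value[where Q = "favourable p n k", OF assms favourable_reply])
  fix G assume "favourable p n k G" and final: "legal_moves n k G = {}"
  then obtain P where "structured_position n k P G" "p = player.Max \<longrightarrow> mergeable k P"
    unfolding favourable_def structured_for_def by blast
  then show "prefers p (card G) (score_bound p n k)"
    using structured_position.card_edges_le structured_position.mergeable_has_legal_move final
    by (cases p) auto
qed

lemma pred_le_choose_2: "n - 1 \<le> n choose 2"
proof (cases n)
  case (Suc m)
  then show ?thesis
    by (cases m) (simp_all add: numeral_2_eq_2)
qed simp

lemma score_few_vertices:
  assumes "n < 2 * k"
  shows "prefers p (score n first (matching_property n k)) (score_bound p n k)"
  using final_size_few_vertices[OF assms] assms pred_le_choose_2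
  by (cases p) (auto simp: score_def intro: binomial_right_mono)

lemma score_favoured:
  assumes "k \<ge> 2" and first: "first = p \<and> even k \<or> first = opponent p \<and> odd k"
  shows "prefers p (score n first (matching_property n k)) (score_bound p n k)"
proof (cases "n < 2 * k")
  case True
  then show ?thesis
    by (rule score_few_vertices)
next
  case False
  let ?singletons = "(\<lambda>v. {v}) ` {1..n}"
  interpret empty: block_structure "{1..n}" ?singletons "{}"
    by (rule block_structure_singletons) simp
  interpret empty: structured_position n k ?singletons "{}"
    using assms(1) False empty.matching_number_eq by unfold_locales simp_all
  have mergeable: "p = player.Max \<longrightarrow> mergeable k ?singletons"
    using assms(1) by (simp add: mergeable_def)
  show ?thesis
  proof (cases "even k")
    case False
    then have "favourable p n k {}"
      using empty.structured_position_axioms mergeable unfolding favourable_def structured_for_def by auto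
    then show ?thesis
      using favourable_value False first by (simp add: score_def)
  next
    case True
    then obtain f where f: "f \<in> legal_moves n k {}" and "favourable p n k {f}"
      using empty.tempo_move[OF _ mergeable] unfolding favourable_def by auto
    then show ?thesis
      using prefers_trans[OF prefers_game_value[OF f] favourable_value] True first by (simp add: score_def)
  qed
qed

theorem theorem1p7:
  fixes n k :: nat and first :: player
  assumes "k \<ge> 2"
  shows "((first = player.Max \<and> even k) \<or> (first = player.Mini \<and> odd k)
            \<longrightarrow> int (score n first (matching_property n k)) \<ge> int n - 1)
       \<and> ((first = player.Max \<and> odd k) \<or> (first = player.Mini \<and> even k)
            \<longrightarrow> score n first (matching_property n k) \<le> (2 * k - 1) choose 2)"
  using score_favoured[OF assms, of first player.Max n] score_favoured[OF assms, of first player.Mini n]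
  by auto

end
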